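(* Let $\mathcal{R}$ be the set of rigid braids in $B_3$ modulo $\Delta^2$, i.e. the set of classes in $B_3/\langle\Delta^2\rangle$ of rigid braids (two braids being identified when they differ by multiplication by a power of the central element $\Delta^2$). The map $$\mathcal{R}\longrightarrow SL_2(\mathbb{N}),\qquad [\beta]\longmapsto M(\beta),$$ which sends each rigid braid $\beta$ to its associated matrix $M(\beta)$ (the transition matrix of $\beta$ with respect to its corresponding train track graph, $\Gamma_1$ or $\Gamma_2$, as specified in the context), is well defined, surjective and $2$-to-$1$: every $M\in SL_2(\mathbb{N})$ has exactly two preimages.
   Context: $\mathbb{N}$ contains $0$. $SL_2(\mathbb{N})$ is the monoid of $2\times 2$ matrices with entries in $\mathbb{N}$ and determinant $1$. Braid group and Garside structure. $B_3=\langle \sigma_1,\sigma_2 : \sigma_1\sigma_2\sigma_1=\sigma_2\sigma_1\sigma_2\rangle$, $B_3^+$ is the submonoid generated by $\sigma_1,\sigma_2$, and $\Delta=\sigma_1\sigma_2\sigma_1$. The element $\Delta^2$ generates the center of $B_3$. Write $\gamma\preccurlyeq\beta$ ($\gamma$ is a prefix of $\beta$) if $\gamma^{-1}\beta\in B_3^+$; this is a lattice order. Simple elements are the $s$ with $1\preccurlyeq s\preccurlyeq\Delta$, namely $1,\sigma_1,\sigma_2,\sigma_1\sigma_2,\sigma_2\sigma_1,\Delta$; proper simple elements are those different from $1$ and $\Delta$. Let $\tau(\beta)=\Delta^{-1}\beta\Delta$ (it exchanges $\sigma_1$ and $\sigma_2$). Every braid has a unique left normal form $\beta=\Delta^s s_1\cdots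 s_k$ with $s\in\mathbb{Z}$, each $s_i$ a proper simple element, and $s_i$ the greatest simple prefix of $s_is_{i+1}\cdots s_k$ for each $i$. The number $k$ is the canonical length of $\beta$. In $B_3$, a product $s_1s_2$ of two proper simple elements is in normal form if and only if the last letter of $s_1$ equals the first letter of $s_2$. Rigidity. A braid $\beta$ with normal form $\Delta^s s_1\cdots s_k$ is rigid if either $k\ge 1$ and the product $s_k\tau^{-s}(s_1)$ is in left normal form, or $\beta=\Delta^s$. Coding of normal forms. A braid with normal form $\Delta^s s_1\cdots s_k$, $k\ge1$, is coded by a unique tuple $(s;i;p_1,q_1,\ldots,p_r,q_r)\in\mathbb{Z}\times\{1,2\}\times\mathbb{N}^{2r}$, $r\geq 1$, where only $p_1$ and $q_r$ may be zero: $\sigma_i$ is the first letter of $s_1$, and, reading $s_1,\dots,s_k$ from left to right, the first $p_1$ factors have length one as words in $\sigma_1,\sigma_2$, the next $q_1$ factors have length two, the next $p_2$ have length one, and so on. The braid $\Delta^s$ is coded by $(s;1;0,0)=(s;2;0,0)$. Associated matrix. Let $$L=\begin{pmatrix}1&0\\1&1\end{pmatrix},\qquad U=\begin{pmatrix}1&1\\0&1\end{pmatrix}.$$ For a rigid braid $\beta$ coded by $(s;i;p_1,q_1,\ldots,p_r,q_r)$, the associated matrix is $$M(\beta)=L^{p_1}U^{q_1}\cdots L^{p_r}U^{q_r}$$ (the identity matrix when $\beta=\Delta^s$). Geometrically, $\Gamma_1$ and $\Gamma_2=\Delta(\Gamma_1)$ are two train track graphs in the $3$-punctured disc, each consisting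 of three loops around the punctures joined by two edges labelled $x,y$. A rigid braid not a power of $\Delta$ has $\Gamma_1$ as train track if ($s$ even, $i=1$) or ($s$ odd, $i=2$), and $\Gamma_2$ otherwise. The matrix $M(\beta)$ is the transition matrix in the ordered edges $x,y$, whose entry $m_{a,b}$ counts the occurrences of the $b$-th edge in the image of the $a$-th edge. For the purposes of this statement, $M(\beta)$ is given by the explicit product above. *)

theory Defs
  imports "HOL-Analysis.Analysis" "HOL-Algebra.Algebra"
begin

section \<open>The braid group on three strands\<close>

text \<open>The index set \<open>{1, 2}\<close> of the two Artin generators.\<close>

datatype idx = I1 | I2

text \<open>
  A letter \<open>(True, i)\<close> stands for \<open>\<sigma>\<^sub>i\<close> and \<open>(False, i)\<close> for its inverse. Two words are
  equivalent if they represent the same element of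
  \<open>\<langle>\<sigma>\<^sub>1, \<sigma>\<^sub>2 : \<sigma>\<^sub>1 \<sigma>\<^sub>2 \<sigma>\<^sub>1 = \<sigma>\<^sub>2 \<sigma>\<^sub>1 \<sigma>\<^sub>2\<rangle>\<close>.
\<close>

type_synonym bword = "(bool \<times> idx) list"

inductive braid_eq :: "bword \<Rightarrow> bword \<Rightarrow> bool" where
  refl: "braid_eq u u"
| sym: "braid_eq u v \<Longrightarrow> braid_eq v u"
| trans: "braid_eq u v \<Longrightarrow> braid_eq v w \<Longrightarrow> braid_eq u w"
| ctxt: "braid_eq u v \<Longrightarrow> braid_eq (x @ u @ y) (x @ v @ y)"
| cancel: "braid_eq [(e, i), (\<not> e, i)] []"
| artin: "braid_eq [(True, I1), (True, I2), (True, I1)] [(True, I2), (True, I1), (True, I2)]"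

lemma braid_eq_append:
  assumes "braid_eq u u'" "braid_eq v v'"
  shows "braid_eq (u @ v) (u' @ v')"
  using braid_eq.ctxt[OF assms(1), of "[]" v] braid_eq.ctxt[OF assms(2), of u' "[]"]
  by (auto intro: braid_eq.trans)

lemma equivp_braid_eq: "equivp braid_eq"
  by (rule equivpI) (auto intro!: reflpI sympI transpI intro: braid_eq.intros)

quotient_type braid = bword / braid_eq
  by (rule equivp_braid_eq)

lift_definition braid_mult :: "braid \<Rightarrow> braid \<Rightarrow> braid" is "(@)"
  by (rule braid_eq_append)

lift_definition braid_one :: braid is "[]" .

lift_definition sigma :: "idx \<Rightarrow> braid" is "\<lambda>i. [(True, i)]" .

definition B3 :: "braid monoid" where
  "B3 = \<lparr>carrier = UNIV, mult = braid_mult, one = braid_one\<rparr>"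

definition word_inv :: "bword \<Rightarrow> bword" where
  "word_inv w = rev (map (\<lambda>(e, i). (\<not> e, i)) w)"

lemma braid_eq_word_inv: "braid_eq (word_inv w @ w) []"
proof (induction w)
  case Nil
  show ?case by (simp add: word_inv_def braid_eq.refl)
next
  case (Cons a w)
  obtain e i where a: "a = (e, i)" by (cases a)
  have "braid_eq (word_inv w @ [(\<not> e, i), (\<not> \<not> e, i)] @ w) (word_inv w @ [] @ w)"
    by (intro braid_eq.ctxt braid_eq.cancel)
  then have "braid_eq (word_inv (a # w) @ a # w) (word_inv w @ w)"
    by (simp add: word_inv_def a)
  then show ?case using Cons.IH by (rule braid_eq.trans)
qed

lemma carrier_B3 [simp]: "carrier B3 = UNIV"
  by (simp add: B3_def)

lemma group_B3: "group B3"
proof (rule groupI)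
  fix x y z :: braid
  show "x \<otimes>\<^bsub>B3\<^esub> y \<otimes>\<^bsub>B3\<^esub> z = x \<otimes>\<^bsub>B3\<^esub> (y \<otimes>\<^bsub>B3\<^esub> z)"
    unfolding B3_def monoid.simps by transfer (simp add: braid_eq.refl)
  show "\<one>\<^bsub>B3\<^esub> \<otimes>\<^bsub>B3\<^esub> x = x"
    unfolding B3_def monoid.simps by transfer (simp add: braid_eq.refl)
  have "\<exists>y. braid_mult y x = braid_one"
    by transfer (blast intro: braid_eq_word_inv)
  then show "\<exists>y\<in>carrier B3. y \<otimes>\<^bsub>B3\<^esub> x = \<one>\<^bsub>B3\<^esub>"
    by (simp add: B3_def)
qed simp_all

lemma artin_relation:
  "sigma I1 \<otimes>\<^bsub>B3\<^esub> sigma I2 \<otimes>\<^bsub>B3\<^esub> sigma I1 = sigma I2 \<otimes>\<^bsub>B3\<^esub> sigma I1 \<otimes>\<^bsub>B3\<^esub> sigma I2"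
  unfolding B3_def monoid.simps by transfer (simp add: braid_eq.artin)


section \<open>Garside structure and left normal forms\<close>

definition Delta :: braid where
  "Delta = sigma I1 \<otimes>\<^bsub>B3\<^esub> sigma I2 \<otimes>\<^bsub>B3\<^esub> sigma I1"

inductive_set B3_pos :: "braid set" where
  one: "\<one>\<^bsub>B3\<^esub> \<in> B3_pos"
| sigma: "sigma i \<in> B3_pos"
| mult: "\<beta> \<in> B3_pos \<Longrightarrow> \<gamma> \<in> B3_pos \<Longrightarrow> \<beta> \<otimes>\<^bsub>B3\<^esub> \<gamma> \<in> B3_pos"

definition braid_prefix :: "braid \<Rightarrow> braid \<Rightarrow> bool" (infix \<open>\<preceq>\<^sub>B\<close> 50) where
  "\<gamma> \<preceq>\<^sub>B \<beta> \<longleftrightarrow> inv\<^bsub>B3\<^esub> \<gamma> \<otimes>\<^bsub>B3\<^esub> \<beta> \<in> B3_pos"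

definition simple_braids :: "braid set" where
  "simple_braids = {s. \<one>\<^bsub>B3\<^esub> \<preceq>\<^sub>B s \<and> s \<preceq>\<^sub>B Delta}"

definition proper_simple_braids :: "braid set" where
  "proper_simple_braids = simple_braids - {\<one>\<^bsub>B3\<^esub>, Delta}"

text \<open>\<open>tau_pow n\<close> is the \<open>n\<close>-th power of the automorphism \<open>\<tau>(\<beta>) = \<Delta>\<^sup>-\<^sup>1 \<beta> \<Delta>\<close>.\<close>

definition tau_pow :: "int \<Rightarrow> braid \<Rightarrow> braid" where
  "tau_pow n \<beta> = Delta [^]\<^bsub>B3\<^esub> (- n) \<otimes>\<^bsub>B3\<^esub> \<beta> \<otimes>\<^bsub>B3\<^esub> Delta [^]\<^bsub>B3\<^esub> n"

definition braid_prod :: "braid list \<Rightarrow> braid" where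
  "braid_prod bs = foldr (\<otimes>\<^bsub>B3\<^esub>) bs \<one>\<^bsub>B3\<^esub>"

definition greatest_simple_prefix :: "braid \<Rightarrow> braid \<Rightarrow> bool" where
  "greatest_simple_prefix s \<beta> \<longleftrightarrow>
     s \<in> simple_braids \<and> s \<preceq>\<^sub>B \<beta> \<and> (\<forall>t\<in>simple_braids. t \<preceq>\<^sub>B \<beta> \<longrightarrow> t \<preceq>\<^sub>B s)"

definition left_normal :: "braid list \<Rightarrow> bool" where
  "left_normal ss \<longleftrightarrow>
     set ss \<subseteq> proper_simple_braids \<and>
     (\<forall>j<length ss. greatest_simple_prefix (ss ! j) (braid_prod (drop j ss)))"

definition left_normal_form :: "braid \<Rightarrow> int \<Rightarrow> braid list \<Rightarrow> bool" where
  "left_normal_form \<beta> s ss \<longleftrightarrow>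
     left_normal ss \<and> \<beta> = Delta [^]\<^bsub>B3\<^esub> s \<otimes>\<^bsub>B3\<^esub> braid_prod ss"

definition rigid :: "braid \<Rightarrow> bool" where
  "rigid \<beta> \<longleftrightarrow>
     (\<exists>s ss. left_normal_form \<beta> s ss \<and>
        (ss = [] \<or> left_normal [last ss, tau_pow (- s) (hd ss)]))"


section \<open>Coding of normal forms and the associated matrix\<close>

definition is_word_of :: "idx list \<Rightarrow> braid \<Rightarrow> bool" where
  "is_word_of w \<beta> \<longleftrightarrow> \<beta> = braid_prod (map sigma w)"

definition has_first_letter :: "braid \<Rightarrow> idx \<Rightarrow> bool" where
  "has_first_letter \<beta> i \<longleftrightarrow> (\<exists>w. is_word_of (i # w) \<beta>)"

definition has_length :: "braid \<Rightarrow> nat \<Rightarrow> bool" where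
  "has_length \<beta> n \<longleftrightarrow> (\<exists>w. is_word_of w \<beta> \<and> length w = n)"

text \<open>
  The exponents \<open>p\<^sub>1, q\<^sub>1, \<dots>, p\<^sub>r, q\<^sub>r\<close> are grouped as the list
  \<open>[(p\<^sub>1, q\<^sub>1), \<dots>, (p\<^sub>r, q\<^sub>r)]\<close>, where \<open>r \<ge> 1\<close> and only \<open>p\<^sub>1\<close> and \<open>q\<^sub>r\<close> may vanish.
\<close>

definition valid_exponents :: "(nat \<times> nat) list \<Rightarrow> bool" where
  "valid_exponents pqs \<longleftrightarrow>
     pqs \<noteq> [] \<and>
     (\<forall>j<length pqs. (j \<noteq> 0 \<longrightarrow> fst (pqs ! j) \<noteq> 0) \<and>
                     (j \<noteq> length pqs - 1 \<longrightarrow> snd (pqs ! j) \<noteq> 0))"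

definition factor_lengths :: "(nat \<times> nat) list \<Rightarrow> nat list" where
  "factor_lengths pqs = concat (map (\<lambda>(p, q). replicate p 1 @ replicate q 2) pqs)"

text \<open>
  If there are no proper simple factors, the lengths force the exponents to be \<open>[(0, 0)]\<close> and
  the index \<open>i\<close> is arbitrary, so that \<open>\<Delta>\<^sup>s\<close> has exactly the two codes \<open>(s; 1; 0, 0)\<close> and
  \<open>(s; 2; 0, 0)\<close>.
\<close>

definition coded_by :: "braid \<Rightarrow> int \<times> idx \<times> (nat \<times> nat) list \<Rightarrow> bool" where
  "coded_by \<beta> = (\<lambda>(s, i, pqs).
     valid_exponents pqs \<and>
     (\<exists>ss. left_normal_form \<beta> s ss \<and>
           (ss \<noteq> [] \<longrightarrow> has_first_letter (hd ss) i) \<and>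
           list_all2 has_length ss (factor_lengths pqs)))"

definition L_mat :: "int^2^2" where
  "L_mat = vector [vector [1, 0], vector [1, 1]]"

definition U_mat :: "int^2^2" where
  "U_mat = vector [vector [1, 1], vector [0, 1]]"

text \<open>Powers for the matrix product; the operations \<open>(*)\<close> and \<open>(^)\<close> on vectors are componentwise.\<close>

definition mat_power :: "int^2^2 \<Rightarrow> nat \<Rightarrow> int^2^2" where
  "mat_power A n = ((\<lambda>B. A ** B) ^^ n) (mat 1)"

definition code_matrix :: "(nat \<times> nat) list \<Rightarrow> int^2^2" where
  "code_matrix pqs =
     foldr (\<lambda>(p, q) B. mat_power L_mat p ** mat_power U_mat q ** B) pqs (mat 1)"

definition assoc_matrix :: "braid \<Rightarrow> int^2^2" where
  "assoc_matrix \<beta> = (THE A. \<exists>s i pqs. coded_by \<beta> (s, i, pqs) \<and> A = code_matrix pqs)"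

definition SL2N :: "(int^2^2) set" where
  "SL2N = {A. (\<forall>i j. A $ i $ j \<in> \<nat>) \<and> det A = 1}"


section \<open>Rigid braids modulo the full twist\<close>

definition full_twists :: "braid set" where
  "full_twists = generate B3 {Delta [^]\<^bsub>B3\<^esub> (2::nat)}"

definition class_mod :: "braid \<Rightarrow> braid set" where
  "class_mod \<beta> = full_twists #>\<^bsub>B3\<^esub> \<beta>"

definition rigid_classes :: "braid set set" where
  "rigid_classes = class_mod ` {\<beta>. rigid \<beta>}"

lemma Delta_sigma:
  "Delta \<otimes>\<^bsub>B3\<^esub> sigma I1 = sigma I2 \<otimes>\<^bsub>B3\<^esub> Delta"
  "Delta \<otimes>\<^bsub>B3\<^esub> sigma I2 = sigma I1 \<otimes>\<^bsub>B3\<^esub> Delta"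
proof -
  interpret group B3 by (rule group_B3)
  show "Delta \<otimes>\<^bsub>B3\<^esub> sigma I1 = sigma I2 \<otimes>\<^bsub>B3\<^esub> Delta"
    unfolding Delta_def by (subst artin_relation) (simp add: m_assoc)
  have "Delta \<otimes>\<^bsub>B3\<^esub> sigma I2
      = sigma I1 \<otimes>\<^bsub>B3\<^esub> (sigma I2 \<otimes>\<^bsub>B3\<^esub> sigma I1 \<otimes>\<^bsub>B3\<^esub> sigma I2)"
    unfolding Delta_def by (simp add: m_assoc)
  then show "Delta \<otimes>\<^bsub>B3\<^esub> sigma I2 = sigma I1 \<otimes>\<^bsub>B3\<^esub> Delta"
    unfolding Delta_def by (simp only: artin_relation)
qed

lemma Delta2_sigma:
  "Delta [^]\<^bsub>B3\<^esub> (2::nat) \<otimes>\<^bsub>B3\<^esub> sigma i = sigma i \<otimes>\<^bsub>B3\<^esub> Delta [^]\<^bsub>B3\<^esub> (2::nat)"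
proof -
  interpret group B3 by (rule group_B3)
  have sq: "Delta [^]\<^bsub>B3\<^esub> (2::nat) = Delta \<otimes>\<^bsub>B3\<^esub> Delta"
    by (simp add: numeral_2_eq_2)
  show ?thesis
  proof (cases i)
    case I1
    have "Delta \<otimes>\<^bsub>B3\<^esub> Delta \<otimes>\<^bsub>B3\<^esub> sigma I1 = Delta \<otimes>\<^bsub>B3\<^esub> sigma I2 \<otimes>\<^bsub>B3\<^esub> Delta"
      by (simp add: m_assoc Delta_sigma(1))
    then show ?thesis by (simp add: I1 sq Delta_sigma(2) m_assoc)
  next
    case I2
    have "Delta \<otimes>\<^bsub>B3\<^esub> Delta \<otimes>\<^bsub>B3\<^esub> sigma I2 = Delta \<otimes>\<^bsub>B3\<^esub> sigma I1 \<otimes>\<^bsub>B3\<^esub> Delta"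
      by (simp add: m_assoc Delta_sigma(2))
    then show ?thesis by (simp add: I2 sq Delta_sigma(1) m_assoc)
  qed
qed

lemma braid_induct:
  assumes "P \<one>\<^bsub>B3\<^esub>"
    and "\<And>i \<beta>. P \<beta> \<Longrightarrow> P (sigma i \<otimes>\<^bsub>B3\<^esub> \<beta>)"
    and "\<And>i \<beta>. P \<beta> \<Longrightarrow> P (inv\<^bsub>B3\<^esub> (sigma i) \<otimes>\<^bsub>B3\<^esub> \<beta>)"
  shows "P \<beta>"
proof -
  interpret group B3 by (rule group_B3)
  have inv_sigma: "abs_braid [(False, i)] = inv\<^bsub>B3\<^esub> (sigma i)" for i
  proof (rule inv_equality[symmetric])
    show "abs_braid [(False, i)] \<otimes>\<^bsub>B3\<^esub> sigma i = \<one>\<^bsub>B3\<^esub>"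
      using braid_eq.cancel[of False i]
      by (simp add: B3_def braid_mult.abs_eq sigma.abs_eq braid_one.abs_eq braid.abs_eq_iff)
  qed simp_all
  have "P (abs_braid w)" for w
  proof (induction w)
    case Nil
    then show ?case using assms(1) by (simp add: B3_def braid_one.abs_eq)
  next
    case (Cons a w)
    obtain e i where a: "a = (e, i)" by (cases a)
    have "abs_braid (a # w) = abs_braid [a] \<otimes>\<^bsub>B3\<^esub> abs_braid w"
      by (simp add: B3_def braid_mult.abs_eq)
    then show ?case
      using assms(2,3)[OF Cons.IH, of i] a inv_sigma[of i] by (cases e) (simp_all add: sigma.abs_eq)
  qed
  then show ?thesis by (metis Quotient3_abs_rep Quotient3_braid)
qed

lemma Delta2_central:
  "Delta [^]\<^bsub>B3\<^esub> (2::nat) \<otimes>\<^bsub>B3\<^esub> \<beta> = \<beta> \<otimes>\<^bsub>B3\<^esub> Delta [^]\<^bsub>B3\<^esub> (2::nat)"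
proof -
  interpret group B3 by (rule group_B3)
  let ?D = "Delta [^]\<^bsub>B3\<^esub> (2::nat)"
  have inv_comm: "?D \<otimes>\<^bsub>B3\<^esub> inv\<^bsub>B3\<^esub> (sigma i) = inv\<^bsub>B3\<^esub> (sigma i) \<otimes>\<^bsub>B3\<^esub> ?D" for i
    using Delta2_sigma[of i] by (metis UNIV_I carrier_B3 inv_solve_left inv_solve_right' m_assoc m_closed inv_closed)
  show ?thesis
  proof (induction \<beta> rule: braid_induct)
    case 1
    show ?case by simp
  next
    case (2 i \<beta>)
    then show ?case using Delta2_sigma[of i] by (metis UNIV_I carrier_B3 m_assoc)
  next
    case (3 i \<beta>)
    then show ?case using inv_comm[of i] by (metis UNIV_I carrier_B3 m_assoc)
  qed
qed

lemma normal_full_twists: "full_twists \<lhd> B3"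
proof -
  interpret group B3 by (rule group_B3)
  show ?thesis
    unfolding full_twists_def
  proof (rule normal_generateI)
    fix h g
    assume "h \<in> {Delta [^]\<^bsub>B3\<^esub> (2::nat)}"
    then show "g \<otimes>\<^bsub>B3\<^esub> h \<otimes>\<^bsub>B3\<^esub> inv\<^bsub>B3\<^esub> g \<in> {Delta [^]\<^bsub>B3\<^esub> (2::nat)}"
      using Delta2_central[of g] by (simp add: m_assoc flip: Delta2_central)
  qed simp
qed

lemma rigid_classes_subset: "rigid_classes \<subseteq> carrier (B3 Mod full_twists)"
  by (auto simp: rigid_classes_def class_mod_def FactGroup_def RCOSETS_def)

end

theory Submission
  imports Defs
begin

text \<open>
  The generators act on pairs \<open>(n, xs)\<close>, thought of as Garside normal forms \<open>\<Delta>\<^sup>n xs\<close>, by left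
  multiplication followed by renormalization. On matched lists of factors this respects the braid
  relation, so applying a braid to \<open>(0, [])\<close> yields an invariant. Positive braids have
  \<open>n \<ge> 0\<close>, which shows that a product of matched factors starting with \<open>\<sigma>\<^sub>i\<close> has no other
  generator as a prefix; hence left normal means matched, and normal forms are unique. A matched
  list is a first letter together with a word in the factor lengths 1 and 2, and rigidity says
  that the number of factors of length 2 has the parity of the exponent of \<open>\<Delta>\<close>. Modulo
  \<open>\<Delta>\<^sup>2\<close> each word of lengths thus comes from exactly two rigid braids, while words of lengths
  correspond to matrices because \<open>SL\<^sub>2(\<nat>)\<close> is free on \<open>L\<close> and \<open>U\<close>.
\<close>

interpretation B3: group B3
  by (rule group_B3)

abbreviation braid_times :: "braid \<Rightarrow> braid \<Rightarrow> braid" (infixl \<open>\<star>\<close> 70) where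
  "x \<star> y \<equiv> x \<otimes>\<^bsub>B3\<^esub> y"

abbreviation Delta_pow :: "int \<Rightarrow> braid" where
  "Delta_pow n \<equiv> Delta [^]\<^bsub>B3\<^esub> n"


section \<open>Braids acting on Garside normal forms\<close>

fun other :: "idx \<Rightarrow> idx" where
  "other I1 = I2"
| "other I2 = I1"

lemma other_other [simp]: "other (other i) = i"
  by (cases i) auto

lemma other_neq [simp]: "other i \<noteq> i" "i \<noteq> other i"
  by (cases i; simp)+

lemma neq_iff_other: "i \<noteq> j \<longleftrightarrow> j = other i"
  by (cases i; cases j) auto

text \<open>Conjugation by \<open>\<Delta>\<close> exchanges the two generators, so this is the
  index that \<open>sigma i\<close> acquires on being moved across
  \<open>Delta_pow n\<close>.\<close>

definition twist :: "int \<Rightarrow> idx \<Rightarrow> idx" where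
  "twist n i = (if even n then i else other i)"

lemma twist_0 [simp]: "twist 0 i = i"
  by (simp add: twist_def)

lemma twist_other: "twist n (other i) = other (twist n i)"
  by (simp add: twist_def)

text \<open>A pair \<open>(i, l)\<close> stands for the proper simple braid with first letter \<open>\<sigma>\<^sub>i\<close> and of length two
  if \<open>l\<close> holds, of length one otherwise; a pair \<open>(n, xs)\<close> stands for \<open>\<Delta>\<^sup>n\<close> times the product
  of the factors \<open>xs\<close>.\<close>

type_synonym factor = "idx \<times> bool"
type_synonym garside = "int \<times> factor list"

definition last_letter :: "factor \<Rightarrow> idx" where
  "last_letter x = (if snd x then other (fst x) else fst x)"

lemma last_letter_simps [simp]:
  "last_letter (i, False) = i" "last_letter (i, True) = other i"
  by (simp_all add: last_letter_def)

fun matched :: "factor list \<Rightarrow> bool" where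
  "matched (x # y # zs) \<longleftrightarrow> last_letter x = fst y \<and> matched (y # zs)"
| "matched _ \<longleftrightarrow> True"

lemma matched_Cons:
  "matched (x # xs) \<longleftrightarrow> matched xs \<and> (xs \<noteq> [] \<longrightarrow> last_letter x = fst (hd xs))"
  by (cases xs) auto

text \<open>Once \<open>\<sigma>\<^sub>i\<close> has been carried past
  \<open>\<Delta>\<^sup>n\<close>, a letter equal to the first letter of the leading factor is
  already matched and stays separate. The other letter merges: with a factor of length one it makes
  a factor of length two, with a factor of length two it completes a \<open>\<Delta>\<close>, which
  joins the power in front.\<close>

fun step :: "idx \<Rightarrow> garside \<Rightarrow> garside" where
  "step i (n, []) = (n, [(twist n i, False)])"
| "step i (n, (f, l) # ys) =
     (if f = twist n i then (n, (twist n i, False) # (f, l) # ys)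
      else if l then (n + 1, ys)
      else (n, (twist n i, True) # ys))"

definition shift :: "int \<Rightarrow> garside \<Rightarrow> garside" where
  "shift m = (\<lambda>(n, xs). (n + m, xs))"

lemma shift_simp [simp]: "shift m (n, xs) = (n + m, xs)"
  by (simp add: shift_def)

lemma shift_shift [simp]: "shift m (shift k x) = shift (m + k) x"
  by (cases x) simp

lemma shift_0 [simp]: "shift 0 x = x"
  by (cases x) simp

lemma fst_shift [simp]: "fst (shift m x) = fst x + m"
  and snd_shift [simp]: "snd (shift m x) = snd x"
  by (cases x; simp)+

lemma step_shift: "step i (shift m x) = shift m (step (twist m i) x)"
  by (cases x; cases "snd x") (auto simp: twist_def)

lemma matched_step: "matched (snd x) \<Longrightarrow> matched (snd (step i x))"
  by (cases x; cases "snd x") (auto simp: matched_Cons neq_iff_other last_letter_def split: if_splits)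

text \<open>As \<open>i\<close> is arbitrary, both sides of the braid relation act by the same
  shift, which is left multiplication by \<open>\<Delta>\<close>.\<close>

lemma step_Delta:
  assumes "matched (snd x)"
  shows "step i (step (other i) (step i x)) = shift 1 x"
proof -
  obtain n xs where x: "x = (n, xs)" by (cases x)
  show ?thesis
  proof (cases xs)
    case Nil
    then show ?thesis by (simp add: x twist_other)
  next
    case (Cons y ys)
    obtain f l where y: "y = (f, l)" by (cases y)
    show ?thesis
    proof (cases "f = twist n i")
      case True
      then show ?thesis by (simp add: x y Cons twist_other)
    next
      case False
      then have f: "f = other (twist n i)" by (simp add: neq_iff_other)
      \<comment> \<open>Matching enters here: the remainder is empty or starts with the last letter
        of \<open>y\<close>, so the letters applied after a \<open>\<Delta>\<close> has split off
        are not absorbed by the remainder and rebuild \<open>y\<close> in front of it.\<close>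
      have ys: "ys = [] \<or> (\<exists>l' zs. ys = (last_letter y, l') # zs)"
        using assms by (cases ys) (auto simp: x y Cons)
      have t: "twist (n + 1) j = other (twist n j)" for j
        by (simp add: twist_def)
      show ?thesis
        using ys by (cases l) (auto simp: x y Cons f t twist_other)
    qed
  qed
qed

text \<open>\<open>\<sigma>\<^sub>i\<^sup>-\<^sup>1 = \<Delta>\<^sup>-\<^sup>1 \<sigma>\<^sub>i \<sigma>\<^sub>j\<close> for \<open>{i, j} = {1, 2}\<close>.\<close>

definition act_letter :: "bool \<times> idx \<Rightarrow> garside \<Rightarrow> garside" where
  "act_letter = (\<lambda>(e, i) x. if e then step i x else shift (- 1) (step i (step (other i) x)))"

lemma act_letter_simps [simp]:
  "act_letter (True, i) x = step i x"
  "act_letter (False, i) x = shift (- 1) (step i (step (other i) x))"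
  by (simp_all add: act_letter_def)

lemma matched_act_letter: "matched (snd x) \<Longrightarrow> matched (snd (act_letter a x))"
  by (auto simp: act_letter_def matched_step split: prod.splits)

lemma matched_act: "matched (snd x) \<Longrightarrow> matched (snd (foldr act_letter w x))"
  by (induction w) (auto intro: matched_act_letter)

lemma act_letter_cancel:
  assumes "matched (snd x)"
  shows "act_letter (e, i) (act_letter (\<not> e, i) x) = x"
proof -
  \<comment> \<open>For \<open>e\<close> true, pulling \<open>shift (- 1)\<close> out of
    \<open>step i\<close> exchanges the index. In both cases three alternating steps remain, which
    amount to \<open>shift 1\<close>.\<close>
  have "twist (- 1) i = other i" by (simp add: twist_def)
  then show ?thesis
    using assms step_Delta[of x i] step_Delta[of x "other i"] by (cases e) (simp_all add: step_shift)
qed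

lemma braid_eq_act:
  assumes "braid_eq u v" "matched (snd x)"
  shows "foldr act_letter u x = foldr act_letter v x"
  using assms
proof (induction arbitrary: x)
  case (cancel e i)
  then show ?case by (simp only: foldr.simps comp_apply id_apply act_letter_cancel)
next
  case artin
  then show ?case using step_Delta[of x I1] step_Delta[of x I2] by simp
qed (simp_all add: matched_act)

section \<open>The Garside normal form as an invariant of braids\<close>

lift_definition nf :: "braid \<Rightarrow> garside" is "\<lambda>w. foldr act_letter w (0, [])"
  by (rule braid_eq_act) simp_all

lemma matched_nf: "matched (snd (nf \<beta>))"
  by transfer (simp add: matched_act)

lemma nf_one [simp]: "nf \<one>\<^bsub>B3\<^esub> = (0, [])"
  unfolding B3_def monoid.simps by transfer simp

lemma nf_sigma_mult [simp]: "nf (sigma i \<star> \<beta>) = step i (nf \<beta>)"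
  unfolding B3_def monoid.simps by transfer simp

lemma nf_Delta_mult [simp]: "nf (Delta \<star> \<beta>) = shift 1 (nf \<beta>)"
  using step_Delta[OF matched_nf, of I1 \<beta>] by (simp add: Delta_def B3.m_assoc)

lemma Delta_pow_add: "Delta_pow (m + n) = Delta_pow m \<star> Delta_pow n"
  by (simp add: B3.int_pow_mult)

lemma nf_Delta_pow_mult [simp]: "nf (Delta_pow m \<star> \<beta>) = shift m (nf \<beta>)"
proof (induction m rule: int_induct[where k = 0])
  case base
  show ?case by simp
next
  case (step1 m)
  have "Delta_pow (m + 1) \<star> \<beta> = Delta \<star> (Delta_pow m \<star> \<beta>)"
    using Delta_pow_add[of 1 m] by (simp add: B3.m_assoc add.commute)
  with step1 show ?case by (simp add: add.commute)
next
  case (step2 m)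
  have "Delta_pow m \<star> \<beta> = Delta \<star> (Delta_pow (m - 1) \<star> \<beta>)"
    using Delta_pow_add[of 1 "m - 1"] by (simp add: B3.m_assoc)
  then have "shift (- 1) (shift m (nf \<beta>)) = shift (- 1) (shift 1 (nf (Delta_pow (m - 1) \<star> \<beta>)))"
    using step2 by simp
  then show ?case by simp
qed


section \<open>Positive braids and their length\<close>

text \<open>The abelianization of the braid group. On positive words it is the word length, so all
  positive words for one braid have equal length.\<close>

lift_definition exponent_sum :: "braid \<Rightarrow> int" is "\<lambda>w. \<Sum>(e, i)\<leftarrow>w. if e then 1 else - 1"
proof -
  fix u v :: bword
  assume "braid_eq u v"
  then show "(\<Sum>(e, i)\<leftarrow>u. if e then 1 else - 1) = (\<Sum>(e, i)\<leftarrow>v. if e then 1 else - (1::int))"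
    by induction auto
qed

lemma exponent_sum_mult [simp]: "exponent_sum (x \<star> y) = exponent_sum x + exponent_sum y"
  unfolding B3_def monoid.simps by transfer simp

lemma exponent_sum_sigma [simp]: "exponent_sum (sigma i) = 1"
  by transfer simp

lemma exponent_sum_one [simp]: "exponent_sum \<one>\<^bsub>B3\<^esub> = 0"
  unfolding B3_def monoid.simps by transfer simp

lemma exponent_sum_inv [simp]: "exponent_sum (inv\<^bsub>B3\<^esub> x) = - exponent_sum x"
proof -
  have "exponent_sum (inv\<^bsub>B3\<^esub> x) + exponent_sum x = 0"
    by (simp flip: exponent_sum_mult)
  then show ?thesis by simp
qed

lemma exponent_sum_Delta [simp]: "exponent_sum Delta = 3"
  by (simp add: Delta_def)

lemma braid_prod_simps [simp]:
  "braid_prod [] = \<one>\<^bsub>B3\<^esub>"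
  "braid_prod (b # bs) = b \<star> braid_prod bs"
  by (simp_all add: braid_prod_def)

lemma braid_prod_append: "braid_prod (xs @ ys) = braid_prod xs \<star> braid_prod ys"
  by (induction xs) (simp_all add: B3.m_assoc)

lemma exponent_sum_word [simp]: "exponent_sum (braid_prod (map sigma w)) = int (length w)"
  by (induction w) simp_all

lemma pos_word: "braid_prod (map sigma w) \<in> B3_pos"
  by (induction w) (auto intro: B3_pos.intros)

lemma pos_iff_word: "\<beta> \<in> B3_pos \<longleftrightarrow> (\<exists>w. \<beta> = braid_prod (map sigma w))"
proof
  assume "\<beta> \<in> B3_pos"
  then show "\<exists>w. \<beta> = braid_prod (map sigma w)"
  proof induction
    case one
    show ?case by (rule exI[of _ "[]"]) simp
  next
    case (sigma i)
    show ?case by (rule exI[of _ "[i]"]) simp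
  next
    case (mult \<beta> \<gamma>)
    then show ?case by (metis braid_prod_append map_append)
  qed
qed (auto simp: pos_word)

lemma pos_exponent_sum: "\<beta> \<in> B3_pos \<Longrightarrow> exponent_sum \<beta> \<ge> 0"
  by (auto simp: pos_iff_word)

lemma step_mono: "fst x \<le> fst (step i x)"
  by (cases x; cases "snd x") auto

lemma pos_nf: 
  assumes "\<beta> \<in> B3_pos"
  shows "fst (nf \<beta>) \<ge> 0"
proof -
  have "fst (nf (braid_prod (map sigma w))) \<ge> 0" for w
    by (induction w) (auto intro: order_trans step_mono)
  then show ?thesis using assms by (auto simp: pos_iff_word)
qed

text \<open>The exponent is nonnegative before the step and 0 after it, so it was 0 and no
  \<open>\<Delta>\<close> arose. The index is then untwisted, and every remaining branch of
  \<open>step\<close> leaves \<open>i\<close> in front.\<close>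

lemma nf_sigma_first_letter:
  assumes "\<beta> \<in> B3_pos" "nf (sigma i \<star> \<beta>) = (0, xs)"
  shows "xs \<noteq> [] \<and> fst (hd xs) = i"
proof -
  have "fst (nf \<beta>) \<ge> 0" using assms(1) by (rule pos_nf)
  then show ?thesis
    using assms(2) by (cases "nf \<beta>"; cases "snd (nf \<beta>)") (auto split: if_splits)
qed

section \<open>The prefix order\<close>

lemma prefix_iff: "x \<preceq>\<^sub>B y \<longleftrightarrow> (\<exists>z\<in>B3_pos. y = x \<star> z)"
proof
  assume "x \<preceq>\<^sub>B y"
  then show "\<exists>z\<in>B3_pos. y = x \<star> z"
    unfolding braid_prefix_def by (intro bexI[of _ "inv\<^bsub>B3\<^esub> x \<star> y"]) (simp_all add: flip: B3.m_assoc)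
next
  assume "\<exists>z\<in>B3_pos. y = x \<star> z"
  then show "x \<preceq>\<^sub>B y"
    unfolding braid_prefix_def by (auto simp: simp flip: B3.m_assoc)
qed

lemma one_prefix_iff: "\<one>\<^bsub>B3\<^esub> \<preceq>\<^sub>B x \<longleftrightarrow> x \<in> B3_pos"
  by (simp add: braid_prefix_def)

lemma prefix_refl: "x \<preceq>\<^sub>B x"
  by (simp add: braid_prefix_def B3_pos.one)

lemma prefix_exponent_sum: "x \<preceq>\<^sub>B y \<Longrightarrow> exponent_sum x \<le> exponent_sum y"
  by (auto simp: prefix_iff dest: pos_exponent_sum)


section \<open>Simple braids and normal forms\<close>

fun braid_of :: "factor \<Rightarrow> braid" where
  "braid_of (i, l) = (if l then sigma i \<star> sigma (other i) else sigma i)"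

lemma Delta_eq: "Delta = sigma i \<star> sigma (other i) \<star> sigma i"
  by (cases i) (simp_all add: Delta_def artin_relation)

lemma nf_sigma [simp]: "nf (sigma i) = (0, [(i, False)])"
  using nf_sigma_mult[of i "\<one>\<^bsub>B3\<^esub>"] by simp

lemma nf_Delta [simp]: "nf Delta = (1, [])"
  using nf_Delta_mult[of "\<one>\<^bsub>B3\<^esub>"] by simp

lemma nf_braid_of: "nf (braid_of x) = (0, [x])"
  by (cases x) (simp add: neq_iff_other)

lemma exponent_sum_braid_of: "exponent_sum (braid_of x) = (if snd x then 2 else 1)"
  by (cases x) simp

lemma pos_braid_of: "braid_of x \<in> B3_pos"
  by (cases x) (auto intro: B3_pos.intros)

lemma pos_sigma_Delta: "Delta \<in> B3_pos"
  unfolding Delta_def by (intro B3_pos.intros)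

text \<open>Since \<open>\<Delta>\<close> has exponent sum 3, a simple braid is a positive word of
  length at most 3; only the squares of the generators have to be excluded.\<close>

lemma simple_cases:
  assumes "s \<in> simple_braids"
  obtains "s = \<one>\<^bsub>B3\<^esub>" | "s = Delta" | x where "s = braid_of x"
proof -
  obtain w v where s: "s = braid_prod (map sigma w)" and D: "Delta = s \<star> braid_prod (map sigma v)"
    using assms by (auto simp: simple_braids_def one_prefix_iff prefix_iff pos_iff_word)
  have len: "length w + length v = 3"
    using arg_cong[OF D, of exponent_sum] by (simp add: s)
  consider "w = []" | i where "w = [i]" | i j where "w = [i, j]" | "v = []"
    using len by (cases w rule: remdups_adj.cases; cases "tl (tl w)") auto
  then show thesis
  proof cases
    case 1
    then show thesis using that(1) s by simp
  next
    case (2 i)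
    then show thesis using that(3)[of "(i, False)"] s by simp
  next
    case (3 i j)
    show thesis
    proof (cases "j = i")
      \<comment> \<open>Three positive letters beginning with a square never complete a
        \<open>\<Delta>\<close>: their normal form has exponent 0, that of \<open>\<Delta>\<close>
        has exponent 1.\<close>
      case True
      obtain k where "v = [k]" using len 3 by (auto simp: length_Suc_conv)
      then show thesis
        using arg_cong[OF D, of "\<lambda>x. fst (nf x)"] s True 3 by (simp add: B3.m_assoc split: if_splits)
    next
      case False
      then show thesis using that(3)[of "(i, True)"] s 3 by (simp add: neq_iff_other)
    qed
  next
    case 4
    then show thesis using that(2) D by simp
  qed
qed

lemma braid_of_simple: "braid_of x \<in> simple_braids"
proof -
  obtain i l where x: "x = (i, l)" by (cases x)
  have "braid_of x \<preceq>\<^sub>B Delta"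
    unfolding prefix_iff
  proof (intro bexI)
    show "Delta = braid_of x \<star> (if l then sigma i else sigma (other i) \<star> sigma i)"
      by (simp add: x Delta_eq[of i] B3.m_assoc)
  qed (auto intro: B3_pos.intros)
  then show ?thesis by (simp add: simple_braids_def one_prefix_iff pos_braid_of)
qed

lemma Delta_simple: "Delta \<in> simple_braids"
  by (simp add: simple_braids_def one_prefix_iff pos_sigma_Delta prefix_refl)

lemma proper_simple_eq: "proper_simple_braids = range braid_of"
proof
  show "proper_simple_braids \<subseteq> range braid_of"
    by (auto simp: proper_simple_braids_def elim: simple_cases)
  have "braid_of x \<noteq> \<one>\<^bsub>B3\<^esub> \<and> braid_of x \<noteq> Delta" for x
    using nf_braid_of[of x] by auto
  then show "range braid_of \<subseteq> proper_simple_braids"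
    by (auto simp: proper_simple_braids_def braid_of_simple simp del: braid_of.simps)
qed

text \<open>In a matched list nothing merges across the boundary between two factors, so
  \<open>step\<close> rebuilds the list factor by factor.\<close>

lemma nf_factors: "matched xs \<Longrightarrow> nf (braid_prod (map braid_of xs)) = (0, xs)"
proof (induction xs)
  case (Cons x xs)
  then have nf: "nf (braid_prod (map braid_of xs)) = (0, xs)" by (simp add: matched_Cons)
  obtain i l where x: "x = (i, l)" by (cases x)
  show ?case
    using nf Cons.prems by (cases xs) (auto simp: x B3.m_assoc last_letter_def)
qed simp

text \<open>The normal form of the product rules out the competing simple prefixes:
  \<open>\<Delta>\<close> would make its exponent positive, and any proper simple prefix must begin
  with the first letter of \<open>x\<close>.\<close>

lemma greatest_simple_prefix_matched:
  assumes "matched (x # xs)"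
  shows "greatest_simple_prefix (braid_of x) (braid_prod (map braid_of (x # xs)))"
proof -
  let ?P = "braid_prod (map braid_of (x # xs))"
  obtain i l where x: "x = (i, l)" by (cases x)
  have nfP: "nf ?P = (0, x # xs)" using assms by (rule nf_factors)
  have pos: "braid_prod (map braid_of ys) \<in> B3_pos" for ys
    by (induction ys) (auto intro: B3_pos.one B3_pos.mult pos_braid_of simp del: braid_of.simps)
  have "t \<preceq>\<^sub>B braid_of x" if t: "t \<in> simple_braids" and tP: "t \<preceq>\<^sub>B ?P" for t
  proof -
    obtain Q where Q: "Q \<in> B3_pos" and P: "?P = t \<star> Q"
      using tP by (auto simp: prefix_iff)
    from t show ?thesis
    proof (cases rule: simple_cases)
      case 1
      then show ?thesis by (simp add: one_prefix_iff pos_braid_of)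
    next
      case 2
      then have "fst (nf ?P) = fst (nf Q) + 1" unfolding P by simp
      with pos_nf[OF Q] show ?thesis unfolding nfP by simp
    next
      case (3 y)
      obtain j m where y: "y = (j, m)" by (cases y)
      \<comment> \<open>What is left of the product after removing only the first letter of
        \<open>t\<close>.\<close>
      define Q' where "Q' = (if m then sigma (other j) \<star> Q else Q)"
      have Q': "?P = sigma j \<star> Q'" "Q' \<in> B3_pos"
        using P 3 y Q by (auto simp: Q'_def B3.m_assoc intro: B3_pos.intros)
      have j: "j = i"
        using nf_sigma_first_letter[OF Q'(2), of j] nfP by (simp add: x flip: Q'(1))
      show ?thesis
      proof (cases "m = l")
        case True
        then show ?thesis using 3 x y j by (simp add: prefix_refl)
      next
        case False
        show ?thesis
        proof (cases m)
          case True
          then have "\<not> l" using False by simp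
          \<comment> \<open>The candidate is longer than \<open>x\<close>. Cancelling
            \<open>sigma i\<close> makes \<open>sigma (other i)\<close> the first letter of the
            remaining factors, whereas matching makes it \<open>sigma i\<close>.\<close>
          then have "sigma i \<star> braid_prod (map braid_of xs) = sigma i \<star> (sigma (other i) \<star> Q)"
            using Q'(1) True by (simp add: x j Q'_def)
          then have "sigma (other i) \<star> Q = braid_prod (map braid_of xs)"
            by simp
          then have "nf (sigma (other i) \<star> Q) = (0, xs)"
            using nf_factors[of xs] assms by (simp add: matched_Cons)
          from nf_sigma_first_letter[OF Q this] have False
            using assms \<open>\<not> l\<close> by (simp add: matched_Cons x last_letter_def)
          then show ?thesis ..
        next
          case False
          then have "l" using \<open>m \<noteq> l\<close> by simp
          then show ?thesis
            using 3 x y j False by (auto simp: prefix_iff intro: B3_pos.sigma)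
        qed
      qed
    qed
  qed
  then show ?thesis
    unfolding greatest_simple_prefix_def
    using pos[of xs] by (auto simp: braid_of_simple prefix_iff simp del: braid_of.simps)
qed

lemma left_normal_Nil: "left_normal []"
  by (simp add: left_normal_def)

lemma left_normal_Cons:
  "left_normal (s # ss) \<longleftrightarrow>
     s \<in> proper_simple_braids \<and> greatest_simple_prefix s (braid_prod (s # ss)) \<and> left_normal ss"
  unfolding left_normal_def by (simp add: All_less_Suc2 del: braid_prod_simps) blast

text \<open>If a factor and its successor fail to match, the first letter of the successor can be
  absorbed into the factor; this gives a simple prefix of larger exponent sum, against
  maximality.\<close>

lemma left_normal_iff: "left_normal ss \<longleftrightarrow> (\<exists>xs. matched xs \<and> ss = map braid_of xs)"
proof
  assume "left_normal ss"
  then show "\<exists>xs. matched xs \<and> ss = map braid_of xs"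
  proof (induction ss)
    case Nil
    show ?case by (rule exI[of _ "[]"]) simp
  next
    case (Cons s ss)
    then obtain x xs where xs: "matched xs" "ss = map braid_of xs" and s: "s = braid_of x"
      by (auto simp: left_normal_Cons proper_simple_eq simp del: braid_of.simps)
    have "last_letter x = fst y" if y: "xs = y # ys" for y ys
    proof (rule ccontr)
      assume neq: "last_letter x \<noteq> fst y"
      obtain i l j m where x: "x = (i, l)" and y': "y = (j, m)" by (cases x, cases y)
      \<comment> \<open>The product after the first letter \<open>j\<close> of \<open>y\<close> has
        been moved over to \<open>x\<close>, forming \<open>t\<close>.\<close>
      define R where "R = (if m then sigma (other j) else \<one>\<^bsub>B3\<^esub>) \<star> braid_prod (map braid_of ys)"
      define t where "t = braid_of x \<star> sigma j"
      have "t \<in> simple_braids"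
      proof (cases l)
        case True
        with neq have "j = i" by (simp add: x y' neq_iff_other)
        then have "t = Delta" using True by (simp add: t_def x Delta_eq[of i])
        then show ?thesis by (simp add: Delta_simple)
      next
        case False
        with neq have "t = braid_of (i, True)" by (simp add: t_def x y' neq_iff_other)
        then show ?thesis by (simp only: braid_of_simple)
      qed
      moreover have "braid_prod (s # ss) = t \<star> R"
        by (simp add: s xs(2) y y' t_def R_def B3.m_assoc del: braid_of.simps)
           (simp add: B3.m_assoc)
      moreover have "R \<in> B3_pos"
      proof -
        have "braid_prod (map braid_of ys) \<in> B3_pos"
          by (induction ys) (auto intro: B3_pos.one B3_pos.mult pos_braid_of simp del: braid_of.simps)
        then show ?thesis by (auto simp: R_def intro: B3_pos.intros)
      qed
      ultimately have "t \<preceq>\<^sub>B s"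
        using Cons.prems unfolding left_normal_Cons greatest_simple_prefix_def prefix_iff by blast
      from prefix_exponent_sum[OF this] show False by (simp add: t_def s)
    qed
    then have "matched (x # xs)" using xs(1) by (cases xs) auto
    then show ?case using xs(2) s by (intro exI[of _ "x # xs"]) simp
  qed
next
  have "left_normal (map braid_of xs)" if "matched xs" for xs
    using that
  proof (induction xs)
    case Nil
    show ?case by (simp add: left_normal_Nil)
  next
    case (Cons x xs)
    then show ?case
      using greatest_simple_prefix_matched[OF Cons.prems]
      by (simp add: left_normal_Cons proper_simple_eq matched_Cons del: braid_of.simps)
  qed
  then show "\<exists>xs. matched xs \<and> ss = map braid_of xs \<Longrightarrow> left_normal ss"
    by blast
qed

lemma left_normal_form_iff:
  "left_normal_form \<beta> s ss \<longleftrightarrow>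
     (\<exists>xs. matched xs \<and> ss = map braid_of xs \<and> \<beta> = Delta_pow s \<star> braid_prod (map braid_of xs))"
  by (auto simp: left_normal_form_def left_normal_iff)


section \<open>Rigid braids\<close>

fun factor_chain :: "idx \<Rightarrow> bool list \<Rightarrow> factor list" where
  "factor_chain i [] = []"
| "factor_chain i (l # ls) = (i, l) # factor_chain (if l then other i else i) ls"

lemma factor_chain_eq_Nil [simp]: "factor_chain i ls = [] \<longleftrightarrow> ls = []"
  by (cases ls) auto

lemma fst_hd_factor_chain [simp]: "ls \<noteq> [] \<Longrightarrow> fst (hd (factor_chain i ls)) = i"
  by (cases ls) auto

lemma map_snd_factor_chain [simp]: "map snd (factor_chain i ls) = ls"
  by (induction ls arbitrary: i) auto

lemma matched_factor_chain: "matched (factor_chain i ls)"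
  by (induction ls arbitrary: i) (auto simp: matched_Cons last_letter_def)

lemma factor_chain_of_matched: "matched xs \<Longrightarrow> factor_chain (fst (hd xs)) (map snd xs) = xs"
proof (induction xs)
  case (Cons x xs)
  obtain i l where x: "x = (i, l)" by (cases x)
  have IH: "factor_chain (fst (hd xs)) (map snd xs) = xs"
    using Cons by (simp add: matched_Cons)
  have prem: "matched (x # xs)" by fact
  show ?case
  proof (cases xs)
    case (Cons y ys)
    then have "fst (hd xs) = (if l then other i else i)"
      using prem by (auto simp: x last_letter_def)
    then show ?thesis
      using IH by (simp add: x Cons)
  qed (simp add: x)
qed simp

lemma matched_iff_factor_chain: "matched xs \<longleftrightarrow> (\<exists>i ls. xs = factor_chain i ls)"
proof
  assume "matched xs"
  from factor_chain_of_matched[OF this, symmetric] show "\<exists>i ls. xs = factor_chain i ls"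
    by (intro exI)
qed (auto simp: matched_factor_chain)

text \<open>Only factors of length two change the current letter, so the parity of their number
  decides.\<close>

lemma last_letter_factor_chain:
  "ls \<noteq> [] \<Longrightarrow> last_letter (last (factor_chain i ls)) = twist (int (count_list ls True)) i"
proof (induction ls arbitrary: i)
  case (Cons l ls)
  then show ?case
    by (cases "ls = []") (auto simp: last_letter_def twist_def)
qed simp

lemma twist_eq_iff: "twist m i = twist n i \<longleftrightarrow> even m = even n"
  by (auto simp: twist_def)

section \<open>Conjugation of proper simple braids by powers of \<open>\<Delta>\<close>\<close>

lemma Delta_mult_sigma: "Delta \<star> sigma i = sigma (other i) \<star> Delta"
  by (cases i) (simp_all add: Delta_sigma)

lemma Delta_pow_sigma: "Delta_pow n \<star> sigma i = sigma (twist n i) \<star> Delta_pow n"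
proof (induction n rule: int_induct[where k = 0])
  case base
  show ?case by simp
next
  case (step1 n)
  have "Delta_pow (n + 1) \<star> sigma i = Delta \<star> (Delta_pow n \<star> sigma i)"
    using Delta_pow_add[of 1 n] by (simp add: B3.m_assoc add.commute)
  also have "\<dots> = (Delta \<star> sigma (twist n i)) \<star> Delta_pow n"
    by (simp add: step1 B3.m_assoc)
  also have "\<dots> = sigma (other (twist n i)) \<star> Delta_pow (n + 1)"
    using Delta_pow_add[of 1 n] by (simp add: Delta_mult_sigma B3.m_assoc add.commute)
  finally show ?case by (simp add: twist_def split: if_splits)
next
  case (step2 n)
  have n: "Delta_pow n = Delta \<star> Delta_pow (n - 1)"
    using Delta_pow_add[of 1 "n - 1"] by simp
  have "Delta \<star> (Delta_pow (n - 1) \<star> sigma i) = sigma (twist n i) \<star> (Delta \<star> Delta_pow (n - 1))"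
    using step2 by (simp add: n B3.m_assoc)
  also have "\<dots> = (Delta \<star> sigma (other (twist n i))) \<star> Delta_pow (n - 1)"
    by (simp add: Delta_mult_sigma flip: B3.m_assoc)
  finally have "Delta_pow (n - 1) \<star> sigma i = sigma (other (twist n i)) \<star> Delta_pow (n - 1)"
    by (simp add: B3.m_assoc)
  then show ?case by (simp add: twist_def split: if_splits)
qed

lemma tau_pow_braid_of: "tau_pow (- n) (braid_of (i, l)) = braid_of (twist n i, l)"
proof -
  have "Delta_pow n \<star> braid_of (i, l) = braid_of (twist n i, l) \<star> Delta_pow n"
  proof (cases l)
    case True
    have "Delta_pow n \<star> (sigma i \<star> sigma (other i)) = Delta_pow n \<star> sigma i \<star> sigma (other i)"
      by (simp add: B3.m_assoc)
    also have "\<dots> = sigma (twist n i) \<star> Delta_pow n \<star> sigma (other i)"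
      by (simp only: Delta_pow_sigma)
    also have "\<dots> = sigma (twist n i) \<star> (Delta_pow n \<star> sigma (other i))"
      by (simp add: B3.m_assoc)
    also have "\<dots> = sigma (twist n i) \<star> sigma (other (twist n i)) \<star> Delta_pow n"
      by (simp add: Delta_pow_sigma twist_other B3.m_assoc)
    finally show ?thesis
      using True by simp
  qed (simp add: Delta_pow_sigma)
  moreover have "Delta_pow n \<star> Delta_pow (- n) = \<one>\<^bsub>B3\<^esub>"
    by (simp flip: Delta_pow_add)
  ultimately show ?thesis
    by (simp add: tau_pow_def B3.m_assoc del: braid_of.simps)
qed

lemma inj_braid_of: "inj braid_of"
proof (rule injI)
  fix x y
  assume "braid_of x = braid_of y"
  from arg_cong[OF this, of nf] show "x = y"
    by (simp add: nf_braid_of del: braid_of.simps)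
qed

lemma left_normal_pair: "left_normal [braid_of x, braid_of y] \<longleftrightarrow> last_letter x = fst y"
proof
  assume "left_normal [braid_of x, braid_of y]"
  then have "\<exists>xs. matched xs \<and> map braid_of [x, y] = map braid_of xs"
    unfolding left_normal_iff list.map .
  \<comment> \<open>Injectivity of \<open>braid_of\<close> identifies the matched list with
    \<open>[x, y]\<close> itself.\<close>
  then have "matched [x, y]"
    unfolding inj_map_eq_map[OF inj_braid_of] by auto
  then show "last_letter x = fst y" by simp
next
  assume "last_letter x = fst y"
  then have "matched [x, y]" by simp
  then have "\<exists>xs. matched xs \<and> map braid_of [x, y] = map braid_of xs" by blast
  then show "left_normal [braid_of x, braid_of y]"
    unfolding left_normal_iff list.map .
qed

text \<open>Coordinates on normal forms, read back by \<open>nf\<close>. For empty \<open>ls\<close>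
  the index \<open>i\<close> leaves no trace.\<close>

definition garside_braid :: "int \<Rightarrow> idx \<Rightarrow> bool list \<Rightarrow> braid" where
  "garside_braid s i ls = Delta_pow s \<star> braid_prod (map braid_of (factor_chain i ls))"

lemma nf_garside_braid [simp]: "nf (garside_braid s i ls) = (s, factor_chain i ls)"
  by (simp add: garside_braid_def nf_factors matched_factor_chain del: braid_of.simps)

lemma left_normal_form_garside_braid:
  "left_normal_form \<beta> s ss \<longleftrightarrow>
     (\<exists>i ls. \<beta> = garside_braid s i ls \<and> ss = map braid_of (factor_chain i ls))"
  unfolding left_normal_form_iff matched_iff_factor_chain garside_braid_def by blast

text \<open>The closing condition compares the last letter, which is \<open>i\<close> twisted once
  per factor of length two, with the first letter \<open>i\<close> twisted by \<open>s\<close>; they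
  agree exactly when the parities do.\<close>

lemma rigid_iff:
  "rigid \<beta> \<longleftrightarrow>
     (\<exists>s i ls. \<beta> = garside_braid s i ls \<and> (ls = [] \<or> even s = even (count_list ls True)))"
proof -
  let ?P = "\<lambda>s ss. ss = [] \<or> left_normal [last ss, tau_pow (- s) (hd ss)]"
  have P: "?P s (map braid_of (factor_chain i ls)) \<longleftrightarrow> ls = [] \<or> even s = even (count_list ls True)" for s i ls
  proof (cases ls)
    case (Cons l ls')
    have "tau_pow (- s) (hd (map braid_of (factor_chain i ls))) = braid_of (twist s i, l)"
      by (simp add: Cons tau_pow_braid_of del: braid_of.simps)
    moreover have "last (map braid_of (factor_chain i ls)) = braid_of (last (factor_chain i ls))"
      by (rule last_map) (simp add: Cons)
    ultimately have "left_normal [last (map braid_of (factor_chain i ls)), tau_pow (- s) (hd (map braid_of (factor_chain i ls)))]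
        \<longleftrightarrow> last_letter (last (factor_chain i ls)) = twist s i"
      by (simp only: left_normal_pair fst_conv)
    also have "\<dots> \<longleftrightarrow> even s = even (count_list ls True)"
    proof -
      have "last_letter (last (factor_chain i ls)) = twist (int (count_list ls True)) i"
        by (rule last_letter_factor_chain) (simp add: Cons)
      then show ?thesis
        by (simp only: twist_eq_iff even_of_nat) blast
    qed
    finally show ?thesis
      by (simp only: map_is_Nil_conv factor_chain_eq_Nil)
  qed simp
  show ?thesis
  proof
    assume "rigid \<beta>"
    then obtain s ss where "left_normal_form \<beta> s ss" and Pss: "?P s ss"
      unfolding rigid_def by auto
    then obtain i ls where \<beta>: "\<beta> = garside_braid s i ls" and ss: "ss = map braid_of (factor_chain i ls)"
      unfolding left_normal_form_garside_braid by auto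
    have "ls = [] \<or> even s = even (count_list ls True)"
      using Pss unfolding ss P .
    with \<beta> show "\<exists>s i ls. \<beta> = garside_braid s i ls \<and> (ls = [] \<or> even s = even (count_list ls True))"
      by (intro exI conjI)
  next
    assume "\<exists>s i ls. \<beta> = garside_braid s i ls \<and> (ls = [] \<or> even s = even (count_list ls True))"
    then obtain s i ls where \<beta>: "\<beta> = garside_braid s i ls"
      and parity: "ls = [] \<or> even s = even (count_list ls True)" by auto
    have "left_normal_form \<beta> s (map braid_of (factor_chain i ls))"
      unfolding left_normal_form_garside_braid using \<beta> by blast
    moreover have "?P s (map braid_of (factor_chain i ls))"
      unfolding P by (rule parity)
    ultimately show "rigid \<beta>"
      unfolding rigid_def by (intro exI conjI)
  qed
qed


section \<open>The associated matrix as a word in L and U\<close>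

definition word_matrix :: "bool list \<Rightarrow> int^2^2" where
  "word_matrix ls = foldr (\<lambda>l B. (if l then U_mat else L_mat) ** B) ls (mat 1)"

lemma word_matrix_simps [simp]:
  "word_matrix [] = mat 1"
  "word_matrix (l # ls) = (if l then U_mat else L_mat) ** word_matrix ls"
  by (simp_all add: word_matrix_def)

lemma word_matrix_append: "word_matrix (xs @ ys) = word_matrix xs ** word_matrix ys"
  by (induction xs) (simp_all add: matrix_mul_assoc)

lemma word_matrix_replicate:
  "word_matrix (replicate n l) = mat_power (if l then U_mat else L_mat) n"
  by (induction n) (simp_all add: mat_power_def)

text \<open>The word of factor lengths behind a code, \<open>True\<close> standing for length two.
  Both the lengths and the matrix of a code depend on the code through this word alone.\<close>

definition expand :: "(nat \<times> nat) list \<Rightarrow> bool list" where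
  "expand pqs = concat (map (\<lambda>(p, q). replicate p False @ replicate q True) pqs)"

lemma factor_lengths_expand: "factor_lengths pqs = map (\<lambda>l. if l then 2 else 1) (expand pqs)"
  by (induction pqs) (auto simp: factor_lengths_def expand_def)

lemma code_matrix_expand: "code_matrix pqs = word_matrix (expand pqs)"
  by (induction pqs)
     (auto simp: code_matrix_def expand_def word_matrix_append word_matrix_replicate matrix_mul_assoc)

lemma valid_exponents_expand: "\<exists>pqs. valid_exponents pqs \<and> expand pqs = ls"
proof (induction ls)
  case Nil
  show ?case by (rule exI[of _ "[(0, 0)]"]) (simp add: valid_exponents_def expand_def)
next
  case (Cons l ls)
  then obtain p q pqs where v: "valid_exponents ((p, q) # pqs)" and e: "expand ((p, q) # pqs) = ls"
    by (metis valid_exponents_def neq_Nil_conv surj_pair)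
  have tl: "\<forall>j<length pqs. fst (pqs ! j) \<noteq> 0 \<and> (j \<noteq> length pqs - 1 \<longrightarrow> snd (pqs ! j) \<noteq> 0)"
    and q: "pqs \<noteq> [] \<longrightarrow> q \<noteq> 0"
    using v by (auto simp: valid_exponents_def All_less_Suc2)
  show ?case
  proof (cases l)
    case False
    have "valid_exponents ((Suc p, q) # pqs)"
      using tl q by (auto simp: valid_exponents_def All_less_Suc2)
    moreover have "expand ((Suc p, q) # pqs) = l # ls"
      using e False by (auto simp: expand_def)
    ultimately show ?thesis by blast
  next
    case True
    show ?thesis
    proof (cases "p = 0")
      case True
      have "valid_exponents ((0, Suc q) # pqs)"
        using tl q by (auto simp: valid_exponents_def All_less_Suc2)
      moreover have "expand ((0, Suc q) # pqs) = l # ls"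
        using e True \<open>l\<close> by (auto simp: expand_def)
      ultimately show ?thesis by blast
    next
      \<comment> \<open>A new block is opened. The old \<open>p\<close> becomes an inner exponent,
        which is allowed as it is nonzero, and the new leading exponent may be 0.\<close>
      case False
      have "valid_exponents ((0, 1) # (p, q) # pqs)"
        using tl q False by (auto simp: valid_exponents_def All_less_Suc2)
      moreover have "expand ((0, 1) # (p, q) # pqs) = l # ls"
        using e \<open>l\<close> by (auto simp: expand_def)
      ultimately show ?thesis by blast
    qed
  qed
qed

section \<open>Codes of a braid and their common matrix\<close>

lemma has_length_braid_of: "has_length (braid_of x) n \<longleftrightarrow> n = (if snd x then 2 else 1)"
proof
  assume "has_length (braid_of x) n"
  then show "n = (if snd x then 2 else 1)"
    using exponent_sum_braid_of[of x]
    by (auto simp: has_length_def is_word_of_def split: if_splits simp del: braid_of.simps)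
next
  obtain i l where x: "x = (i, l)" by (cases x)
  assume "n = (if snd x then 2 else 1)"
  then show "has_length (braid_of x) n"
    unfolding has_length_def is_word_of_def
    by (intro exI[of _ "if l then [i, other i] else [i]"]) (simp add: x)
qed

lemma list_all2_has_length:
  "list_all2 has_length (map braid_of xs) (factor_lengths pqs) \<longleftrightarrow> map snd xs = expand pqs"
proof -
  have "list_all2 has_length (map braid_of xs) (map (\<lambda>l. if l then 2 else 1) ls)
    \<longleftrightarrow> map snd xs = ls" for ls
    by (induction xs arbitrary: ls; case_tac ls)
       (auto simp: has_length_braid_of split: if_splits simp del: braid_of.simps)
  then show ?thesis by (simp add: factor_lengths_expand)
qed

text \<open>All codes of a braid give one matrix, since \<open>nf\<close> recovers the word of
  lengths from the braid; this justifies the description in \<open>assoc_matrix\<close>.\<close>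

lemma coded_by_matrix:
  assumes "coded_by \<beta> (s, i, pqs)"
  shows "code_matrix pqs = word_matrix (map snd (snd (nf \<beta>)))"
proof -
  obtain j ls where "\<beta> = garside_braid s j ls"
    and "list_all2 has_length (map braid_of (factor_chain j ls)) (factor_lengths pqs)"
    using assms unfolding coded_by_def left_normal_form_garside_braid by blast
  then show ?thesis
    unfolding list_all2_has_length by (simp add: code_matrix_expand)
qed

lemma coded_by_exists: "\<exists>pqs. coded_by (garside_braid s i ls) (s, i, pqs)"
proof -
  obtain pqs where pqs: "valid_exponents pqs" "expand pqs = ls"
    using valid_exponents_expand by blast
  have "has_first_letter (braid_of (i, l)) i" for l
    unfolding has_first_letter_def is_word_of_def
    by (intro exI[of _ "if l then [other i] else []"]) simp
  then have "ls \<noteq> [] \<Longrightarrow> has_first_letter (hd (map braid_of (factor_chain i ls))) i"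
    by (cases ls) (auto simp del: braid_of.simps)
  moreover have "list_all2 has_length (map braid_of (factor_chain i ls)) (factor_lengths pqs)"
    unfolding list_all2_has_length by (simp add: pqs)
  moreover have "left_normal_form (garside_braid s i ls) s (map braid_of (factor_chain i ls))"
    unfolding left_normal_form_garside_braid by blast
  ultimately have "coded_by (garside_braid s i ls) (s, i, pqs)"
    using pqs(1) unfolding coded_by_def prod.case map_is_Nil_conv factor_chain_eq_Nil
    by (intro conjI exI[of _ "map braid_of (factor_chain i ls)"]) auto
  then show ?thesis by blast
qed

lemma assoc_matrix_garside_braid: "assoc_matrix (garside_braid s i ls) = word_matrix ls"
  unfolding assoc_matrix_def
proof (rule the_equality)
  show "\<exists>s' i' pqs. coded_by (garside_braid s i ls) (s', i', pqs) \<and> word_matrix ls = code_matrix pqs"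
    using coded_by_exists[of s i ls] coded_by_matrix by fastforce
qed (auto dest: coded_by_matrix)


section \<open>Unique factorization in the monoid of nonnegative unimodular matrices\<close>

lemma matrix2_eq_iff:
  fixes A B :: "'a^2^2"
  shows "A = B \<longleftrightarrow> A$1$1 = B$1$1 \<and> A$1$2 = B$1$2 \<and> A$2$1 = B$2$1 \<and> A$2$2 = B$2$2"
  by (auto simp: vec_eq_iff forall_2)

lemma L_mat_mult [simp]:
  "(L_mat ** B) $ 1 $ j = B $ 1 $ j" "(L_mat ** B) $ 2 $ j = B $ 1 $ j + B $ 2 $ j"
  by (simp_all add: L_mat_def matrix_matrix_mult_def sum_2)

lemma U_mat_mult [simp]:
  "(U_mat ** B) $ 1 $ j = B $ 1 $ j + B $ 2 $ j" "(U_mat ** B) $ 2 $ j = B $ 2 $ j"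
  by (simp_all add: U_mat_def matrix_matrix_mult_def sum_2)

lemma SL2N_iff:
  "A \<in> SL2N \<longleftrightarrow> 0 \<le> A$1$1 \<and> 0 \<le> A$1$2 \<and> 0 \<le> A$2$1 \<and> 0 \<le> A$2$2
     \<and> A$1$1 * A$2$2 - A$1$2 * A$2$1 = 1"
proof -
  have "x \<in> \<nat> \<longleftrightarrow> 0 \<le> x" for x :: int
    using Ints_of_int[of x, where 'a = int] by (auto simp: Nats_altdef2)
  then show ?thesis by (auto simp: SL2N_def forall_2 det_2)
qed

lemma mat_1_entries [simp]:
  "(mat 1 :: int^2^2) $ 1 $ 1 = 1" "(mat 1 :: int^2^2) $ 1 $ 2 = 0"
  "(mat 1 :: int^2^2) $ 2 $ 1 = 0" "(mat 1 :: int^2^2) $ 2 $ 2 = 1"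
  by (simp_all add: mat_def)

lemma SL2N_mult_closed:
  assumes "A \<in> SL2N"
  shows "L_mat ** A \<in> SL2N" "U_mat ** A \<in> SL2N"
proof -
  have "det (L_mat ** A) = 1" "det (U_mat ** A) = 1"
    using assms by (simp_all add: det_mul SL2N_def) (simp_all add: det_2 L_mat_def U_mat_def)
  moreover have "\<forall>i j. 0 \<le> A $ i $ j"
    using assms by (simp add: SL2N_iff forall_2)
  ultimately show "L_mat ** A \<in> SL2N" "U_mat ** A \<in> SL2N"
    by (simp_all add: SL2N_iff det_2)
qed

lemma word_matrix_SL2N: "word_matrix ls \<in> SL2N"
proof (induction ls)
  case Nil
  show ?case by (simp add: SL2N_iff)
qed (simp add: SL2N_mult_closed)

text \<open>Euclidean algorithm on the rows: subtracting the smaller row from the larger one splits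
  off a factor \<open>L_mat\<close> or \<open>U_mat\<close> and lowers the sum of the
  entries.\<close>

lemma word_matrix_surj: "A \<in> SL2N \<Longrightarrow> \<exists>ls. A = word_matrix ls"
proof (induction "nat (A$1$1 + A$1$2 + A$2$1 + A$2$2)" arbitrary: A rule: less_induct)
  case less
  define a b c d where abcd: "a = A$1$1" "b = A$1$2" "c = A$2$1" "d = A$2$2"
  have nn: "0 \<le> a" "0 \<le> b" "0 \<le> c" "0 \<le> d" and det: "a * d - b * c = 1"
    using less.prems by (auto simp: SL2N_iff abcd)
  \<comment> \<open>Either one row dominates the other, or the two columns compare strictly in
    opposite directions.\<close>
  consider "a \<le> c \<and> b \<le> d" | "c \<le> a \<and> d \<le> b" | "c < a \<and> b < d" | "a < c \<and> d < b"
    by (metis le_less linorder_not_le)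
  then show ?case
  proof cases
    case 1
    define B :: "int^2^2" where "B = vector [vector [a, b], vector [c - a, d - b]]"
    \<comment> \<open>A zero row would make the determinant 0, so the subtraction strictly lowers
      the sum.\<close>
    have "a + b > 0" using nn det by (cases "a = 0 \<and> b = 0") auto
    then have "nat (B$1$1 + B$1$2 + B$2$1 + B$2$2) < nat (A$1$1 + A$1$2 + A$2$1 + A$2$2)"
      using nn by (simp add: B_def flip: abcd)
    moreover have "B \<in> SL2N" using 1 nn det by (simp add: SL2N_iff B_def algebra_simps)
    ultimately obtain ls where "B = word_matrix ls" using less.hyps by blast
    moreover have "A = L_mat ** B" by (simp add: matrix2_eq_iff B_def abcd)
    ultimately show ?thesis by (intro exI[of _ "False # ls"]) simp
  next
    case 2
    define B :: "int^2^2" where "B = vector [vector [a - c, b - d], vector [c, d]]"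
    have "c + d > 0" using nn det by (cases "c = 0 \<and> d = 0") auto
    then have "nat (B$1$1 + B$1$2 + B$2$1 + B$2$2) < nat (A$1$1 + A$1$2 + A$2$1 + A$2$2)"
      using nn by (simp add: B_def flip: abcd)
    moreover have "B \<in> SL2N" using 2 nn det by (simp add: SL2N_iff B_def algebra_simps)
    ultimately obtain ls where "B = word_matrix ls" using less.hyps by blast
    moreover have "A = U_mat ** B" by (simp add: matrix2_eq_iff B_def abcd)
    ultimately show ?thesis by (intro exI[of _ "True # ls"]) simp
  next
    case 3
    \<comment> \<open>With \<open>a * d = b * c + 1\<close> this gives \<open>b + c \<le> 0\<close>,
      so only the identity remains.\<close>
    have "(c + 1) * (b + 1) \<le> a * d" using 3 nn by (intro mult_mono) auto
    then have "b = 0" "c = 0" using nn det by (auto simp: algebra_simps)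
    moreover from this have "a = 1" "d = 1" using nn det by (auto simp: zmult_eq_1_iff)
    ultimately have "A = mat 1" by (simp add: matrix2_eq_iff abcd)
    then show ?thesis by (intro exI[of _ "[]"]) simp
  next
    case 4
    have "a * d \<le> c * b" using 4 nn by (intro mult_mono) auto
    then show ?thesis using det by (simp add: mult.commute)
  qed
qed

text \<open>On the left the second row dominates the first, on the right the first dominates the
  second. A common value would have equal rows, forcing the second row of \<open>A\<close> to
  vanish.\<close>

lemma L_mat_mult_neq_U_mat_mult:
  assumes "A \<in> SL2N" "B \<in> SL2N"
  shows "L_mat ** A \<noteq> U_mat ** B"
proof
  assume "L_mat ** A = U_mat ** B"
  then have eq: "A$1$j = B$1$j + B$2$j" "A$1$j + A$2$j = B$2$j" for j
    by (metis L_mat_mult U_mat_mult)+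
  have "A$2$1 = 0" "A$2$2 = 0"
    using assms eq[of 1] eq[of 2] by (auto simp: SL2N_iff)
  with assms(1) show False by (simp add: SL2N_iff)
qed

lemma word_matrix_inj: "word_matrix ls = word_matrix ls' \<Longrightarrow> ls = ls'"
proof (induction ls arbitrary: ls')
  case Nil
  show ?case
  proof (cases ls')
    case (Cons l ms)
    then show ?thesis
      using Nil word_matrix_SL2N[of ms] by (auto simp: matrix2_eq_iff SL2N_iff split: if_splits)
  qed simp
next
  case (Cons l ls)
  show ?case
  proof (cases ls')
    case Nil
    then show ?thesis
      using Cons.prems word_matrix_SL2N[of ls] by (auto simp: matrix2_eq_iff SL2N_iff split: if_splits)
  next
    case (Cons m ms)
    note neq = L_mat_mult_neq_U_mat_mult[OF word_matrix_SL2N word_matrix_SL2N]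
    have "l = m"
      using Cons.prems Cons neq neq[symmetric] by (cases l; cases m) auto
    moreover from this have "word_matrix ls = word_matrix ms"
      using Cons.prems Cons by (cases m) (auto simp: matrix2_eq_iff)
    ultimately show ?thesis using Cons.IH Cons by simp
  qed
qed


section \<open>Classes modulo the full twist\<close>

lemma full_twists_eq: "full_twists = range (\<lambda>k. Delta_pow (2 * k))"
proof -
  have "Delta [^]\<^bsub>B3\<^esub> (2::nat) = Delta_pow 2"
    using int_pow_int[of B3 Delta 2] by simp
  then show ?thesis
    by (auto simp: full_twists_def B3.generate_pow B3.int_pow_pow)
qed

lemma class_mod_eq: "class_mod \<beta> = range (\<lambda>k. Delta_pow (2 * k) \<star> \<beta>)"
  by (auto simp: class_mod_def full_twists_eq r_coset_def)

lemma class_mod_self: "\<beta> \<in> class_mod \<beta>"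
  unfolding class_mod_eq by (rule range_eqI[of _ _ 0]) simp

text \<open>Even powers of \<open>\<Delta>\<close> merely shift the exponent by an even
  amount.\<close>

lemma class_mod_nf:
  "\<gamma> \<in> class_mod \<beta> \<Longrightarrow> snd (nf \<gamma>) = snd (nf \<beta>) \<and> even (fst (nf \<gamma>)) = even (fst (nf \<beta>))"
  by (auto simp: class_mod_eq)

lemma class_mod_garside_braid:
  assumes "even s = even t"
  shows "class_mod (garside_braid s i ls) = class_mod (garside_braid t i ls)"
proof -
  have "even (s - t)" using assms by simp
  then obtain k where "s - t = 2 * k" by (rule evenE)
  then have k: "s = 2 * k + t" by simp
  have "garside_braid s i ls \<in> class_mod (garside_braid t i ls)"
    unfolding class_mod_eq garside_braid_def k Delta_pow_add
    by (rule range_eqI[of _ _ k]) (simp add: B3.m_assoc)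
  then show ?thesis
    unfolding class_mod_def
    by (intro B3.repr_independence[symmetric]) (simp_all add: normal_full_twists normal_imp_subgroup)
qed

text \<open>A nonempty word leaves the choice of the first letter, the parity of the exponent of \<open>\<Delta>\<close>
  being forced by rigidity; for the empty word it is the parity that is free.\<close>

definition rigid_lift :: "idx \<Rightarrow> bool list \<Rightarrow> braid" where
  "rigid_lift i ls =
     (if ls = [] then garside_braid (if i = I1 then 0 else 1) I1 []
      else garside_braid (int (count_list ls True)) i ls)"

lemma rigid_rigid_lift: "rigid (rigid_lift i ls)"
proof -
  have "rigid (garside_braid s i ls)" if "ls = [] \<or> even s = even (count_list ls True)" for s i ls
    using that unfolding rigid_iff by blast
  then show ?thesis by (simp add: rigid_lift_def)
qed

lemma assoc_matrix_rigid_lift: "assoc_matrix (rigid_lift i ls) = word_matrix ls"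
  by (simp add: rigid_lift_def assoc_matrix_garside_braid)

lemma rigid_class_cases:
  assumes "rigid \<beta>"
  obtains i ls where "class_mod \<beta> = class_mod (rigid_lift i ls)" "assoc_matrix \<beta> = word_matrix ls"
    "map snd (snd (nf \<beta>)) = ls"
proof -
  obtain s i ls where b: "\<beta> = garside_braid s i ls" and p: "ls = [] \<or> even s = even (count_list ls True)"
    using assms unfolding rigid_iff by blast
  have "\<exists>j. class_mod \<beta> = class_mod (rigid_lift j ls)"
  proof (cases "ls = []")
    case True
    \<comment> \<open>For the empty word the index of \<open>rigid_lift\<close> encodes the parity
      of the exponent: \<open>I1\<close> for even, \<open>I2\<close> for odd.\<close>
    define j where "j = (if even s then I1 else I2)"
    have "class_mod \<beta> = class_mod (garside_braid s I1 [])"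
      by (simp add: b True garside_braid_def)
    also have "\<dots> = class_mod (garside_braid (if j = I1 then 0 else 1) I1 [])"
      by (rule class_mod_garside_braid) (simp add: j_def)
    finally show ?thesis
      by (intro exI[of _ j]) (simp add: rigid_lift_def True)
  next
    case False
    have "class_mod \<beta> = class_mod (garside_braid (int (count_list ls True)) i ls)"
      unfolding b using False p by (intro class_mod_garside_braid) simp
    then show ?thesis
      by (intro exI[of _ i]) (simp add: rigid_lift_def False)
  qed
  then obtain j where "class_mod \<beta> = class_mod (rigid_lift j ls)" ..
  then show thesis
    by (rule that) (simp_all add: b assoc_matrix_garside_braid)
qed

lemma class_mod_rigid_lift_neq: "class_mod (rigid_lift I1 ls) \<noteq> class_mod (rigid_lift I2 ls)"
proof
  assume "class_mod (rigid_lift I1 ls) = class_mod (rigid_lift I2 ls)"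
  then have "rigid_lift I1 ls \<in> class_mod (rigid_lift I2 ls)"
    using class_mod_self by metis
  \<comment> \<open>For a nonempty word the first letters of the factor lists differ; for the empty
    word the exponents 0 and 1 differ in parity.\<close>
  from class_mod_nf[OF this] show False
    by (cases ls) (simp_all add: rigid_lift_def)
qed

section \<open>The matrix map on rigid classes and its fibres\<close>

theorem theorem1p1:
  shows "\<exists>F :: braid set \<Rightarrow> int^2^2.
           (\<forall>\<beta>. rigid \<beta> \<longrightarrow> F (class_mod \<beta>) = assoc_matrix \<beta>) \<and>
           F \<in> rigid_classes \<rightarrow> SL2N \<and>
           F ` rigid_classes = SL2N \<and>
           (\<forall>A\<in>SL2N. card {C \<in> rigid_classes. F C = A} = 2)"
proof -
  \<comment> \<open>Any representative will do, because the word of factor lengths is constant on a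
    class.\<close>
  define F :: "braid set \<Rightarrow> int^2^2" where
    "F C = word_matrix (map snd (snd (nf (SOME \<beta>. \<beta> \<in> C))))" for C
  have F: "F (class_mod \<beta>) = assoc_matrix \<beta>" if "rigid \<beta>" for \<beta>
  proof -
    have "(SOME \<gamma>. \<gamma> \<in> class_mod \<beta>) \<in> class_mod \<beta>"
      using class_mod_self by (rule someI)
    then have "F (class_mod \<beta>) = word_matrix (map snd (snd (nf \<beta>)))"
      using class_mod_nf by (simp add: F_def)
    with that show ?thesis by (metis rigid_class_cases)
  qed
  have F_lift: "F (class_mod (rigid_lift i ls)) = word_matrix ls" for i ls
    by (simp add: F rigid_rigid_lift assoc_matrix_rigid_lift)
  have lift_class: "class_mod (rigid_lift i ls) \<in> rigid_classes" for i ls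
    by (auto simp: rigid_classes_def rigid_rigid_lift)
  have classE: "\<exists>i ls. C = class_mod (rigid_lift i ls)" if C: "C \<in> rigid_classes" for C
  proof -
    obtain \<beta> where "rigid \<beta>" "C = class_mod \<beta>"
      using C by (auto simp: rigid_classes_def)
    then show ?thesis by (metis rigid_class_cases)
  qed
  have into: "F \<in> rigid_classes \<rightarrow> SL2N"
    using classE F_lift word_matrix_SL2N by (metis Pi_I)
  have "card {C \<in> rigid_classes. F C = A} = 2" if A_in: "A \<in> SL2N" for A
  proof -
    obtain ls where A: "A = word_matrix ls" using word_matrix_surj[OF A_in] by blast
    \<comment> \<open>Freeness determines the word from \<open>A\<close>, so only the choice of
      index in \<open>rigid_lift\<close> is left.\<close>
    have "{C \<in> rigid_classes. F C = A} = {class_mod (rigid_lift I1 ls), class_mod (rigid_lift I2 ls)}"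
    proof (intro equalityI subsetI)
      fix C
      assume "C \<in> {C \<in> rigid_classes. F C = A}"
      then obtain i ms where "C = class_mod (rigid_lift i ms)" "F C = A"
        using classE by blast
      moreover from this have "ms = ls" using F_lift A word_matrix_inj by metis
      ultimately show "C \<in> {class_mod (rigid_lift I1 ls), class_mod (rigid_lift I2 ls)}"
        by (cases i) auto
    qed (auto simp: lift_class F_lift A)
    then show ?thesis by (simp add: class_mod_rigid_lift_neq)
  qed
  moreover have "SL2N \<subseteq> F ` rigid_classes"
    using word_matrix_surj F_lift lift_class by (metis image_eqI subsetI)
  ultimately show ?thesis using F into by (intro exI[of _ F]) blast
qed

end
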